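(* Let $M\subseteq\mathbb{R}^d$ be a free $\mathbb{Z}$-module of rank $k$ spanning $\mathbb{R}^d$, and let $E$ be the identity. Then $\mathrm{Scal}_M(E)$ is a ring of algebraic integers; in particular it is a ring with unity and a finitely generated free $\mathbb{Z}$-module whose rank is a divisor of $k$ and is at most $k/d$. Moreover, $\mathrm{scal}_M(E)$ is the field of quotients of $\mathrm{Scal}_M(E)$.
   Context: A free $\mathbb{Z}$-module of rank $k$ in $\mathbb{R}^d$ is $M=\langle t_1,\dots,t_k\rangle_{\mathbb{Z}}$ with $t_1,\dots,t_k\in\mathbb{R}^d$ rationally independent and spanning $\mathbb{R}^d$. A submodule of $M$ means a $\mathbb{Z}$-submodule of finite index. Two modules $M_1,M_2$ are commensurate, $M_1\sim M_2$, if $M_1\cap M_2$ is a submodule (finite index) of both. For $R\in\mathrm{O}(d,\mathbb{R})$: $\mathrm{Scal}_M(R):=\{\alpha\in\mathbb{R}\mid\alpha RM\subseteq M\}$ and $\mathrm{scal}_M(R):=\{\alpha\in\mathbb{R}\mid \alpha RM\sim M\}$.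
   Formalization: With scal_M(E) as defined, 0 is never an element (0·M = {0} has infinite index in M), so it cannot be a field; the formal theorem states that scal_M(E) together with 0 is the field of quotients of Scal_M(E). *)

theory Defs
  imports "HOL-Analysis.Analysis" "HOL-Algebra.Algebraic_Closure_Type"
begin

global_interpretation int_module: Modules.module
  "\<lambda>(n::int) (x::'a::real_vector). real_of_int n *\<^sub>R x"
  by unfold_locales (simp_all add: scaleR_add_right scaleR_add_left)

global_interpretation rat_space: Vector_Spaces.vector_space
  "\<lambda>(q::rat) (x::'a::real_vector). (of_rat q :: real) *\<^sub>R x"
  by unfold_locales (simp_all add: scaleR_add_right scaleR_add_left of_rat_add of_rat_mult)

text \<open>\<^term>\<open>span\<close> below is the real linear span. A finite set \<^term>\<open>T\<close> of cardinality
  \<^term>\<open>k\<close> stands for the list of generators, which are distinct because they are independent.\<close>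

definition free_int_module_in_space :: "'a::real_vector set \<Rightarrow> nat \<Rightarrow> bool" where
  "free_int_module_in_space M k \<longleftrightarrow>
     (\<exists>T. finite T \<and> card T = k \<and> rat_space.independent T \<and> span T = UNIV
          \<and> M = int_module.span T)"

definition free_int_module_of_rank :: "'a::real_vector set \<Rightarrow> nat \<Rightarrow> bool" where
  "free_int_module_of_rank S r \<longleftrightarrow>
     (\<exists>B. finite B \<and> card B = r \<and> int_module.independent B \<and> S = int_module.span B)"

definition finite_index_submodule :: "'a::real_vector set \<Rightarrow> 'a set \<Rightarrow> bool" where
  "finite_index_submodule N M \<longleftrightarrow>
     int_module.subspace N \<and> N \<subseteq> M \<and> finite ((\<lambda>x. (+) x ` N) ` M)"

definition commensurate :: "'a::real_vector set \<Rightarrow> 'a set \<Rightarrow> bool" where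
  "commensurate M1 M2 \<longleftrightarrow>
     finite_index_submodule (M1 \<inter> M2) M1 \<and> finite_index_submodule (M1 \<inter> M2) M2"

definition Scal :: "(real ^ 'n) set \<Rightarrow> real ^ 'n ^ 'n \<Rightarrow> real set" where
  "Scal M R = {\<alpha>. (\<lambda>x. \<alpha> *\<^sub>R (R *v x)) ` M \<subseteq> M}"

text \<open>For a nonzero free module \<^term>\<open>M\<close>, the zero module has infinite index in \<^term>\<open>M\<close>,
  so \<^term>\<open>0\<close> never belongs to the following set; it has to be adjoined to obtain a field.\<close>

definition scal :: "(real ^ 'n) set \<Rightarrow> real ^ 'n ^ 'n \<Rightarrow> real set" where
  "scal M R = {\<alpha>. commensurate ((\<lambda>x. \<alpha> *\<^sub>R (R *v x)) ` M) M}"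

definition field_of_quotients :: "'a::Fields.field set \<Rightarrow> 'a set \<Rightarrow> bool" where
  "field_of_quotients K A \<longleftrightarrow>
     subfield K ring_of_type_algebra \<and> K = {a / b | a b. a \<in> A \<and> b \<in> A \<and> b \<noteq> 0}"

end

theory Submission
  imports Defs
begin

text \<open>Let \<open>A\<close> be the ring of real \<open>\<alpha>\<close> with \<open>\<alpha>M \<subseteq> M\<close>. For \<open>0 \<noteq> t \<in> M\<close> the map \<open>\<alpha> \<mapsto> \<alpha>t\<close> embeds \<open>A\<close>
  into \<open>M\<close>, so \<open>A\<close> is free of finite rank \<open>r\<close>. If \<open>0 \<noteq> \<alpha> \<in> A\<close>, then \<open>\<alpha>M\<close> has full rank in \<open>M\<close> and so
  \<open>nM \<subseteq> \<alpha>M\<close> for some \<open>n > 0\<close>, that is, \<open>n/\<alpha> \<in> A\<close>. Hence \<open>K = \<rat>A\<close> is a field of degree \<open>r\<close>, and it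
  consists of all \<open>\<alpha>\<close> with \<open>n\<alpha> \<in> A\<close> for some \<open>n > 0\<close>; for \<open>\<alpha> \<noteq> 0\<close> this means that \<open>\<alpha>M\<close> and \<open>M\<close> are
  commensurate. The space \<open>\<rat>M\<close> has dimension \<open>k/r\<close> over \<open>K\<close>, and a \<open>K\<close>-basis of it spans the
  ambient space over the reals, whence \<open>k/r \<ge> d\<close>.\<close>

section \<open>Integer spans versus rational spans\<close>

lemma int_module_hom_scaleR_left:
  "module_hom (\<lambda>(n::int) (x::real). real_of_int n *\<^sub>R x)
     (\<lambda>(n::int) (x::'a::real_vector). real_of_int n *\<^sub>R x) (\<lambda>\<alpha>. \<alpha> *\<^sub>R v)"
  by unfold_locales (simp_all add: algebra_simps)

lemma int_module_hom_scaleR_right: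
  "module_hom (\<lambda>(n::int) (x::'a::real_vector). real_of_int n *\<^sub>R x)
     (\<lambda>(n::int) (x::'a::real_vector). real_of_int n *\<^sub>R x) (\<lambda>x. \<alpha> *\<^sub>R x)"
  by unfold_locales (simp_all add: algebra_simps)

lemma rat_module_hom_scaleR_left:
  "module_hom (\<lambda>(q::rat) (x::real). (of_rat q :: real) *\<^sub>R x)
     (\<lambda>(q::rat) (x::'a::real_vector). (of_rat q :: real) *\<^sub>R x) (\<lambda>\<alpha>. \<alpha> *\<^sub>R v)"
  by unfold_locales (simp_all add: algebra_simps of_rat_add of_rat_mult)

lemma rat_module_hom_scaleR_right:
  "module_hom (\<lambda>(q::rat) (x::'a::real_vector). (of_rat q :: real) *\<^sub>R x)
     (\<lambda>(q::rat) (x::'a::real_vector). (of_rat q :: real) *\<^sub>R x) (\<lambda>x. \<alpha> *\<^sub>R x)"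
  by unfold_locales (simp_all add: algebra_simps of_rat_add of_rat_mult)

lemma rat_subspace_imp_int_subspace:
  assumes "rat_space.subspace S"
  shows "int_module.subspace S"
proof (rule int_module.subspaceI)
  show "0 \<in> S" using assms by (rule rat_space.subspace_0)
  show "x + y \<in> S" if "x \<in> S" "y \<in> S" for x y using assms that by (rule rat_space.subspace_add)
  show "real_of_int c *\<^sub>R x \<in> S" if "x \<in> S" for c x
    using rat_space.subspace_scale[OF assms that, of "of_int c"] by simp
qed

lemma int_span_subset_rat_span: "int_module.span T \<subseteq> rat_space.span T"
  by (intro int_module.span_minimal rat_space.span_superset rat_subspace_imp_int_subspace
      rat_space.subspace_span)

lemma rat_independent_imp_int_independent:
  assumes "rat_space.independent T"
  shows "int_module.independent T"
proof
  assume "int_module.dependent T"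
  then obtain t u where t: "finite t" "t \<subseteq> T" "(\<Sum>v\<in>t. real_of_int (u v) *\<^sub>R v) = 0"
    and "\<exists>v\<in>t. u v \<noteq> (0::int)"
    unfolding int_module.dependent_explicit by blast
  then obtain v where v: "v \<in> t" "u v \<noteq> 0" by blast
  have "(\<Sum>v\<in>t. (of_rat (of_int (u v)) :: real) *\<^sub>R v) = 0" using t by simp
  then have "(of_int (u v) :: rat) = 0"
    by (rule rat_space.independentD[OF assms t(1,2) _ v(1)])
  with v show False by simp
qed

text \<open>Denominators are cleared along the induction: if \<open>n\<close> clears
  \<open>y\<close> and \<open>c = a / b\<close>, then \<open>n * b\<close> clears
  \<open>c x + y\<close>.\<close>

lemma rat_span_int_multiple:
  assumes "x \<in> rat_space.span T"
  shows "\<exists>n>0. real_of_int n *\<^sub>R x \<in> int_module.span T"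
  using assms
proof (induction rule: rat_space.span_induct_alt)
  case base
  show ?case by (intro exI[of _ 1]) (simp add: int_module.span_zero)
next
  case (step c x y)
  then obtain n where n: "n > 0" "real_of_int n *\<^sub>R y \<in> int_module.span T" by blast
  obtain a b where c: "c = Rat.Fract a b" "b > 0" by (cases c) auto
  have "real_of_int (n * a) *\<^sub>R x + real_of_int b *\<^sub>R (real_of_int n *\<^sub>R y) \<in> int_module.span T"
    by (intro int_module.span_add int_module.span_scale int_module.span_base step n)
  also have "real_of_int (n * a) *\<^sub>R x + real_of_int b *\<^sub>R (real_of_int n *\<^sub>R y)
      = real_of_int (n * b) *\<^sub>R (of_rat c *\<^sub>R x + y)"
    using c by (simp add: of_rat_rat scaleR_add_right mult.commute)
  finally show ?case using n c by (intro exI[of _ "n * b"]) simp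
qed

text \<open>Multiples that serve the single generators multiply to one that serves the whole span.
  This turns pointwise facts about generators into uniform facts about the module.\<close>

lemma int_span_common_multiple:
  assumes "finite T" "int_module.subspace N"
    and "\<And>t. t \<in> T \<Longrightarrow> \<exists>n>0. real_of_int n *\<^sub>R t \<in> N"
  shows "\<exists>n>0. \<forall>x\<in>int_module.span T. real_of_int n *\<^sub>R x \<in> N"
  using assms(1,3)
proof (induction T rule: finite_induct)
  case empty
  show ?case using int_module.subspace_0[OF assms(2)] by (intro exI[of _ 1]) simp
next
  case (insert t T)
  then obtain n where n: "n > 0" "\<forall>x\<in>int_module.span T. real_of_int n *\<^sub>R x \<in> N" by blast
  obtain m where m: "m > 0" "real_of_int m *\<^sub>R t \<in> N" using insert.prems by blast
  have "real_of_int (n * m) *\<^sub>R x \<in> N" if x: "x \<in> int_module.span (insert t T)" for x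
  proof -
    obtain k where k: "x - real_of_int k *\<^sub>R t \<in> int_module.span T"
      using x int_module.span_breakdown_eq by blast
    have "real_of_int m *\<^sub>R (real_of_int n *\<^sub>R (x - real_of_int k *\<^sub>R t))
        + real_of_int (n * k) *\<^sub>R (real_of_int m *\<^sub>R t) \<in> N"
      using k n(2) m(2)
      by (blast intro: int_module.subspace_add[OF assms(2)] int_module.subspace_scale[OF assms(2)])
    also have "real_of_int m *\<^sub>R (real_of_int n *\<^sub>R (x - real_of_int k *\<^sub>R t))
        + real_of_int (n * k) *\<^sub>R (real_of_int m *\<^sub>R t) = real_of_int (n * m) *\<^sub>R x"
      by (simp add: algebra_simps)
    finally show ?thesis .
  qed
  then show ?case using n m by (intro exI[of _ "n * m"]) simp
qed

section \<open>Submodules of free modules and finite index\<close>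

text \<open>Induction on the basis: the \<open>t\<close>-coordinates of elements of \<open>S\<close>
  form an ideal of the integers. If it is nonzero, an element of \<open>S\<close> realising its
  generator extends a basis of the part of \<open>S\<close> inside the span of \<open>T\<close>. The
  basis found is rationally independent, so that it can later serve as a basis of a rational vector
  space.\<close>

lemma int_submodule_basis:
  assumes "finite T" "rat_space.independent T" "int_module.subspace S" "S \<subseteq> int_module.span T"
  shows "\<exists>B. finite B \<and> rat_space.independent B \<and> S = int_module.span B"
  using assms
proof (induction T arbitrary: S rule: finite_induct)
  case empty
  then have "S = {0}" using int_module.subspace_0 by auto
  then show ?case by (intro exI[of _ "{}"]) (simp add: rat_space.independent_empty)
next
  case (insert t T)
  have indT: "rat_space.independent T" "t \<notin> rat_space.span T"
    using insert.prems(1) insert.hyps(2) by (simp_all add: rat_space.independent_insert)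
  note sub = insert.prems(2)
  define S' where "S' = S \<inter> int_module.span T"
  have "int_module.subspace S'"
    unfolding S'_def by (intro int_module.subspace_inter sub int_module.subspace_span)
  then obtain B where B: "finite B" "rat_space.independent B" "S' = int_module.span B"
    using insert.IH[OF indT(1)] S'_def by blast
  \<comment> \<open>The set of \<open>c\<close> with \<open>I c\<close> is the ideal of
    \<open>t\<close>-coordinates of elements of \<open>S\<close>.\<close>
  define I where "I c \<longleftrightarrow> (\<exists>x\<in>S. x - real_of_int c *\<^sub>R t \<in> int_module.span T)" for c
  have ex: "\<exists>c. x - real_of_int c *\<^sub>R t \<in> int_module.span T" if "x \<in> S" for x
    using insert.prems(3) that int_module.span_breakdown_eq by blast
  show ?case
  proof (cases "\<exists>n. n > 0 \<and> I (int n)")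
    case False
    have "x \<in> int_module.span T" if x: "x \<in> S" for x
    proof -
      obtain c where c: "x - real_of_int c *\<^sub>R t \<in> int_module.span T" using ex[OF x] by blast
      have "I c" using c x I_def by blast
      \<comment> \<open>The case assumption excludes positive coordinates only; a negative one is
        ruled out by passing to \<open>- x\<close>.\<close>
      have "- x - real_of_int (- c) *\<^sub>R t \<in> int_module.span T"
        using int_module.span_neg[OF c] by simp
      moreover have "- x \<in> S" using int_module.subspace_neg[OF sub x] .
      ultimately have "I (- c)" using I_def by blast
      have "c = 0"
      proof (rule ccontr)
        assume "c \<noteq> 0"
        then have "nat \<bar>c\<bar> > 0" "I (int (nat \<bar>c\<bar>))"
          using \<open>I c\<close> \<open>I (- c)\<close> by (auto simp: abs_if)
        with False show False by blast
      qed
      with c show ?thesis by simp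
    qed
    then have "S = S'" unfolding S'_def by blast
    with B show ?thesis by blast
  next
    case True
    \<comment> \<open>The least positive coordinate generates the ideal; \<open>x0\<close> below
      realises it.\<close>
    define n where "n = (LEAST n. n > 0 \<and> I (int n))"
    have n: "n > 0" "I (int n)" using LeastI_ex[OF True] unfolding n_def by auto
    have least: "n \<le> m" if "m > 0" "I (int m)" for m
      unfolding n_def by (rule Least_le) (use that in simp)
    obtain x0 where x0: "x0 \<in> S" "x0 - real_of_int (int n) *\<^sub>R t \<in> int_module.span T"
      using n(2) unfolding I_def by blast
    \<comment> \<open>Otherwise \<open>n t\<close>, and hence \<open>t\<close>, would lie in the
      rational span of \<open>T\<close>, against independence.\<close>
    have "x0 \<notin> rat_space.span T"
    proof
      assume "x0 \<in> rat_space.span T"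
      then have "x0 - (x0 - real_of_int (int n) *\<^sub>R t) \<in> rat_space.span T"
        using x0(2) int_span_subset_rat_span by (blast intro: rat_space.span_diff)
      then have "of_rat (inverse (of_nat n)) *\<^sub>R (x0 - (x0 - real_of_int (int n) *\<^sub>R t)) \<in> rat_space.span T"
        by (rule rat_space.span_scale)
      then have "t \<in> rat_space.span T" using n(1) by (simp add: of_rat_inverse)
      with indT show False by blast
    qed
    moreover have "rat_space.span B \<subseteq> rat_space.span T"
    proof (rule rat_space.span_minimal)
      show "B \<subseteq> rat_space.span T"
        using B(3) int_module.span_superset[of B] int_span_subset_rat_span[of T] unfolding S'_def by blast
    qed (rule rat_space.subspace_span)
    ultimately have "x0 \<notin> rat_space.span B" by blast
    then have ind: "rat_space.independent (insert x0 B)" using B(2) by (rule rat_space.independent_insertI)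
    have "S = int_module.span (insert x0 B)"
    proof
      have "insert x0 B \<subseteq> S" using x0 B(3) int_module.span_superset[of B] unfolding S'_def by blast
      then show "int_module.span (insert x0 B) \<subseteq> S" using sub by (rule int_module.span_minimal)
    next
      show "S \<subseteq> int_module.span (insert x0 B)"
      proof
        fix x assume x: "x \<in> S"
        obtain c where c: "x - real_of_int c *\<^sub>R t \<in> int_module.span T" using ex[OF x] by blast
        \<comment> \<open>Division with remainder: subtracting \<open>q\<close> copies of
          \<open>x0\<close> leaves an element of \<open>S\<close> with coordinate
          \<open>r < n\<close>, and minimality of \<open>n\<close> forces
          \<open>r = 0\<close>.\<close>
        define q where "q = c div int n"
        define r where "r = c mod int n"
        have r: "0 \<le> r" "r < int n" using n unfolding r_def by simp_all
        have cq: "c = q * int n + r" unfolding q_def r_def by simp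
        define y where "y = x - real_of_int q *\<^sub>R x0"
        have y: "y \<in> S" unfolding y_def
          by (intro int_module.subspace_diff[OF sub] int_module.subspace_scale[OF sub] x x0)
        have "(x - real_of_int c *\<^sub>R t) - real_of_int q *\<^sub>R (x0 - real_of_int (int n) *\<^sub>R t)
            \<in> int_module.span T"
          by (intro int_module.span_diff int_module.span_scale c x0)
        also have "(x - real_of_int c *\<^sub>R t) - real_of_int q *\<^sub>R (x0 - real_of_int (int n) *\<^sub>R t)
            = y - real_of_int r *\<^sub>R t"
          unfolding y_def cq by (simp add: algebra_simps)
        finally have yr: "y - real_of_int r *\<^sub>R t \<in> int_module.span T" .
        with y have "I r" unfolding I_def by blast
        have "r = 0"
        proof (rule ccontr)
          assume "r \<noteq> 0"
          then have "n \<le> nat r" using least[of "nat r"] \<open>I r\<close> r by simp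
          with r show False by simp
        qed
        with yr have "y \<in> int_module.span T" by simp
        with y have "y \<in> int_module.span B" using B(3) unfolding S'_def by blast
        then show "x \<in> int_module.span (insert x0 B)"
          unfolding y_def int_module.span_breakdown_eq by blast
      qed
    qed
    with ind B(1) show ?thesis by blast
  qed
qed

text \<open>With finitely many generators, having finitely many cosets amounts to one positive
  \<open>n\<close> killing them all. Pigeonhole on the multiples of each generator gives one
  direction; for the other, reducing coefficients modulo \<open>n\<close> leaves finitely many
  representatives.\<close>

lemma finite_cosets_iff:
  assumes "finite T" "int_module.subspace N"
  shows "finite ((\<lambda>x. (+) x ` N) ` int_module.span T) \<longleftrightarrow>
    (\<exists>n>0. \<forall>x\<in>int_module.span T. real_of_int n *\<^sub>R x \<in> N)" (is "finite (?c ` ?P) \<longleftrightarrow> _")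
proof
  assume fin: "finite (?c ` ?P)"
  show "\<exists>n>0. \<forall>x\<in>?P. real_of_int n *\<^sub>R x \<in> N"
  proof (rule int_span_common_multiple[OF assms])
    fix t assume t: "t \<in> T"
    \<comment> \<open>Two of the infinitely many multiples \<open>j t\<close> share a coset; the
      difference of their indices is the required \<open>n\<close>.\<close>
    have "range (\<lambda>j::nat. ?c (real_of_int (int j) *\<^sub>R t)) \<subseteq> ?c ` ?P"
      using int_module.span_scale[OF int_module.span_base[OF t]] by blast
    then have "finite (range (\<lambda>j::nat. ?c (real_of_int (int j) *\<^sub>R t)))"
      using fin finite_subset by blast
    then have "\<not> inj (\<lambda>j::nat. ?c (real_of_int (int j) *\<^sub>R t))"
      using finite_imageD infinite_UNIV_nat by blast
    then obtain i j :: nat where ij: "i < j"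
      and eq: "?c (real_of_int (int i) *\<^sub>R t) = ?c (real_of_int (int j) *\<^sub>R t)"
      unfolding inj_def by (metis linorder_neqE_nat)
    have "real_of_int (int j) *\<^sub>R t + 0 \<in> ?c (real_of_int (int i) *\<^sub>R t)"
      unfolding eq using int_module.subspace_0[OF assms(2)] by blast
    then have "real_of_int (int j) *\<^sub>R t - real_of_int (int i) *\<^sub>R t \<in> N" by (auto simp: algebra_simps)
    then have "real_of_int (int j - int i) *\<^sub>R t \<in> N" by (simp add: scaleR_diff_left)
    then show "\<exists>n>0. real_of_int n *\<^sub>R t \<in> N" using ij by (intro exI[of _ "int j - int i"]) simp
  qed
next
  assume "\<exists>n>0. \<forall>x\<in>?P. real_of_int n *\<^sub>R x \<in> N"
  then obtain n where n: "n > 0" "\<And>x. x \<in> ?P \<Longrightarrow> real_of_int n *\<^sub>R x \<in> N" by blast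
  have coset_eq: "?c x = ?c y" if "x - y \<in> N" for x y
  proof -
    have "z - x \<in> N \<longleftrightarrow> z - y \<in> N" for z
      using int_module.subspace_add[OF assms(2), of "z - x" "x - y"]
        int_module.subspace_diff[OF assms(2), of "z - y" "x - y"] that by auto
    moreover have "z \<in> ?c w \<longleftrightarrow> z - w \<in> N" for z w
    proof
      show "z - w \<in> N" if "z \<in> ?c w" using that by auto
      show "z \<in> ?c w" if "z - w \<in> N" using that by (intro image_eqI[of _ _ "z - w"]) simp_all
    qed
    ultimately show ?thesis by blast
  qed
  \<comment> \<open>Extensional functions have a fixed value off \<open>T\<close>, which makes this
    set finite.\<close>
  let ?F = "PiE T (\<lambda>_. {0..<n})"
  have "?c ` ?P \<subseteq> (\<lambda>g. ?c (\<Sum>t\<in>T. real_of_int (g t) *\<^sub>R t)) ` ?F"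
  proof (rule image_subsetI)
    fix x assume "x \<in> int_module.span T"
    then obtain u where u: "x = (\<Sum>t\<in>T. real_of_int (u t) *\<^sub>R t)"
      using int_module.span_finite[OF assms(1)] by auto
    define g where "g = restrict (\<lambda>t. u t mod n) T"
    have "(\<Sum>t\<in>T. real_of_int (u t) *\<^sub>R t) - (\<Sum>t\<in>T. real_of_int (g t) *\<^sub>R t)
        = (\<Sum>t\<in>T. real_of_int (u t - g t) *\<^sub>R t)"
      by (simp add: sum_subtractf algebra_simps)
    also have "\<dots> = (\<Sum>t\<in>T. real_of_int n *\<^sub>R (real_of_int (u t div n) *\<^sub>R t))"
    proof (rule sum.cong)
      fix t assume "t \<in> T"
      then have "u t - g t = n * (u t div n)" unfolding g_def by (simp add: minus_mod_eq_mult_div)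
      then show "real_of_int (u t - g t) *\<^sub>R t = real_of_int n *\<^sub>R (real_of_int (u t div n) *\<^sub>R t)"
        by simp
    qed simp
    also have "\<dots> \<in> N"
      by (intro int_module.subspace_sum[OF assms(2)] n(2) int_module.span_scale int_module.span_base)
    finally have "?c x = ?c (\<Sum>t\<in>T. real_of_int (g t) *\<^sub>R t)" unfolding u by (rule coset_eq)
    moreover have "g \<in> ?F" unfolding g_def using n(1) by auto
    ultimately show "?c x \<in> (\<lambda>g. ?c (\<Sum>t\<in>T. real_of_int (g t) *\<^sub>R t)) ` ?F" by blast
  qed
  moreover have "finite ?F" using assms(1) by (simp add: finite_PiE)
  ultimately show "finite (?c ` ?P)" by (rule finite_surj[rotated])
qed


section \<open>Independent families and the tower law\<close>

text \<open>Independence of the image as a set loses sight of repeated values, so injectivity is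
  proved along with it; counting the products \<open>b c\<close> in the tower law needs
  both.\<close>

lemma rat_independent_family:
  fixes f :: "'i \<Rightarrow> 'a::real_vector"
  assumes "finite I"
    and ind: "\<And>q. (\<Sum>i\<in>I. of_rat (q i) *\<^sub>R f i) = 0 \<Longrightarrow> \<forall>i\<in>I. q i = 0"
  shows "inj_on f I" "rat_space.independent (f ` I)"
proof -
  show inj: "inj_on f I"
  proof (rule inj_onI, rule ccontr)
    fix i j assume ij: "i \<in> I" "j \<in> I" "f i = f j" "i \<noteq> j"
    \<comment> \<open>A collision \<open>f i = f j\<close> yields the nontrivial relation with
      coefficients 1 and -1.\<close>
    define q :: "'i \<Rightarrow> rat" where "q k = (if k = i then 1 else if k = j then -1 else 0)" for k
    have "(\<Sum>k\<in>I. of_rat (q k) *\<^sub>R f k) = (\<Sum>k\<in>{i,j}. of_rat (q k) *\<^sub>R f k)"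
      by (rule sum.mono_neutral_right) (use assms(1) ij in \<open>auto simp: q_def\<close>)
    also have "\<dots> = 0" using ij by (simp add: q_def of_rat_minus)
    finally have "q i = 0" using ind ij by blast
    then show False by (simp add: q_def)
  qed
  show "rat_space.independent (f ` I)"
  proof
    assume "rat_space.dependent (f ` I)"
    then obtain u where u: "\<exists>v\<in>f ` I. u v \<noteq> 0" "(\<Sum>v\<in>f ` I. of_rat (u v) *\<^sub>R v) = 0"
      using rat_space.dependent_finite[of "f ` I"] assms(1) by auto
    from u(2) have "(\<Sum>i\<in>I. of_rat (u (f i)) *\<^sub>R f i) = 0"
      by (simp add: sum.reindex[OF inj])
    then have "\<forall>i\<in>I. u (f i) = 0" by (rule ind)
    with u(1) show False by blast
  qed
qed

text \<open>The tower law for a vector space over a number field \<open>K\<close>, in the form that a maximal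
  \<open>K\<close>-independent subset \<open>C\<close> of a rational basis \<open>T\<close> turns \<open>B \<times> C\<close> into another rational basis.\<close>

lemma card_rat_basis_over_number_field:
  fixes K :: "real set" and T :: "'a::real_vector set"
  assumes B: "finite B" "rat_space.independent B" "K = rat_space.span B"
    and K1: "1 \<in> K"
    and Kmult: "\<And>x y. x \<in> K \<Longrightarrow> y \<in> K \<Longrightarrow> x * y \<in> K"
    and Kinv: "\<And>x. x \<in> K \<Longrightarrow> inverse x \<in> K"
    and T: "finite T" "rat_space.independent T"
    and stable: "\<And>x v. x \<in> K \<Longrightarrow> v \<in> T \<Longrightarrow> x *\<^sub>R v \<in> rat_space.span T"
  shows "\<exists>C\<subseteq>T. card T = card B * card C \<and> T \<subseteq> span C"
proof -
  have Ksub: "rat_space.subspace K" unfolding B(3) by (rule rat_space.subspace_span)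
  \<comment> \<open>Linear independence over \<open>K\<close>, spelled out with coefficients because
    \<open>K\<close> is a set of reals and not a type of scalars.\<close>
  define ind where "ind C \<longleftrightarrow> (\<forall>x. (\<forall>c\<in>C. x c \<in> K) \<longrightarrow> (\<Sum>c\<in>C. x c *\<^sub>R c) = 0 \<longrightarrow> (\<forall>c\<in>C. x c = 0))"
    for C :: "'a set"
  have "finite {C. C \<subseteq> T \<and> ind C}" using T(1) by simp
  moreover have "{} \<in> {C. C \<subseteq> T \<and> ind C}" by (simp add: ind_def)
  ultimately have "\<exists>C\<in>{C. C \<subseteq> T \<and> ind C}. \<forall>D\<in>{C. C \<subseteq> T \<and> ind C}. C \<subseteq> D \<longrightarrow> C = D"
    by (intro finite_has_maximal) auto
  then obtain C where C: "C \<subseteq> T" "ind C"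
    and max: "D \<subseteq> T \<Longrightarrow> ind D \<Longrightarrow> C \<subseteq> D \<Longrightarrow> C = D" for D
    unfolding Ball_def Bex_def mem_Collect_eq by metis
  have finC: "finite C" using C(1) T(1) finite_subset by blast
  have comb: "\<exists>x. (\<forall>c\<in>C. x c \<in> K) \<and> t = (\<Sum>c\<in>C. x c *\<^sub>R c)" if t: "t \<in> T" for t
  proof (cases "t \<in> C")
    case True
    have "(\<Sum>c\<in>C. (if c = t then 1 else 0) *\<^sub>R c) = (\<Sum>c\<in>C. if c = t then c else 0)"
      by (rule sum.cong) auto
    also have "\<dots> = t" using finC True by simp
    finally show ?thesis
      using K1 rat_space.subspace_0[OF Ksub]
      by (intro exI[of _ "\<lambda>c. if c = t then 1 else 0"]) simp
  next
    case False
    \<comment> \<open>By maximality \<open>t\<close> takes part in a \<open>K\<close>-relation with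
      \<open>C\<close>. Its coefficient is nonzero because \<open>C\<close> is independent, so
      dividing by it expresses \<open>t\<close> through \<open>C\<close>.\<close>
    with t C(1) max[of "insert t C"] have "\<not> ind (insert t C)" by blast
    then obtain x where x: "\<forall>c\<in>insert t C. x c \<in> K" "(\<Sum>c\<in>insert t C. x c *\<^sub>R c) = 0"
      "\<exists>c\<in>insert t C. x c \<noteq> 0" unfolding ind_def by blast
    have eq: "x t *\<^sub>R t + (\<Sum>c\<in>C. x c *\<^sub>R c) = 0" using x(2) False finC by simp
    have "x t \<noteq> 0"
    proof
      assume "x t = 0"
      with eq have "\<forall>c\<in>C. x c = 0" using C(2) x(1) unfolding ind_def by auto
      with \<open>x t = 0\<close> x(3) show False by blast
    qed
    have "x t *\<^sub>R t = - (\<Sum>c\<in>C. x c *\<^sub>R c)" using eq by (simp add: eq_neg_iff_add_eq_0)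
    then have "inverse (x t) *\<^sub>R (x t *\<^sub>R t) = inverse (x t) *\<^sub>R (- (\<Sum>c\<in>C. x c *\<^sub>R c))" by simp
    then have "t = (\<Sum>c\<in>C. (- (inverse (x t) * x c)) *\<^sub>R c)"
      using \<open>x t \<noteq> 0\<close> by (simp add: scaleR_sum_right sum_negf)
    moreover have "- (inverse (x t) * x c) \<in> K" if "c \<in> C" for c
    proof (rule rat_space.subspace_neg[OF Ksub], rule Kmult)
      show "inverse (x t) \<in> K" using x(1) by (intro Kinv) simp
      show "x c \<in> K" using x(1) that by simp
    qed
    ultimately show ?thesis by (intro exI[of _ "\<lambda>c. - (inverse (x t) * x c)"]) simp
  qed
  define f where "f = (\<lambda>(b::real, c::'a). b *\<^sub>R c)"
  \<comment> \<open>Collecting the terms with equal \<open>c\<close> gives coefficients in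
    \<open>K\<close>. Independence of \<open>C\<close> over \<open>K\<close> kills these, and then
    rational independence of \<open>B\<close> kills each \<open>q (b, c)\<close>.\<close>
  have fam: "\<forall>i\<in>B \<times> C. q i = 0" if q: "(\<Sum>i\<in>B \<times> C. of_rat (q i) *\<^sub>R f i) = 0" for q
  proof -
    define x where "x c = (\<Sum>b\<in>B. of_rat (q (b, c)) *\<^sub>R b)" for c
    have xK: "x c \<in> K" for c
      unfolding x_def B(3)
      by (intro rat_space.span_sum rat_space.span_scale rat_space.span_base)
    have "(\<Sum>i\<in>B \<times> C. of_rat (q i) *\<^sub>R f i) = (\<Sum>b\<in>B. \<Sum>c\<in>C. of_rat (q (b, c)) *\<^sub>R f (b, c))"
      by (simp add: sum.cartesian_product)
    also have "\<dots> = (\<Sum>c\<in>C. \<Sum>b\<in>B. of_rat (q (b, c)) *\<^sub>R f (b, c))" by (rule sum.swap)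
    also have "\<dots> = (\<Sum>c\<in>C. x c *\<^sub>R c)"
      by (simp add: x_def f_def scaleR_sum_left)
    finally have "\<forall>c\<in>C. x c = 0" using q C(2) xK unfolding ind_def by auto
    then have "q (b, c) = 0" if "b \<in> B" "c \<in> C" for b c
      using rat_space.independentD[OF B(2) B(1) order_refl, of "\<lambda>b. q (b, c)" b] that
      unfolding x_def by simp
    then show ?thesis by auto
  qed
  have finBC: "finite (B \<times> C)" using B(1) finC by simp
  note P = rat_independent_family[where f = f, OF finBC fam]
  have scaleP: "x *\<^sub>R c \<in> rat_space.span (f ` (B \<times> C))" if x: "x \<in> K" and c: "c \<in> C" for x c
  proof -
    interpret h: module_hom "\<lambda>(q::rat) (x::real). (of_rat q :: real) *\<^sub>R x"
      "\<lambda>(q::rat) (x::'a). (of_rat q :: real) *\<^sub>R x" "\<lambda>\<alpha>. \<alpha> *\<^sub>R c"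
      by (rule rat_module_hom_scaleR_left)
    have "x *\<^sub>R c \<in> rat_space.span ((\<lambda>\<alpha>. \<alpha> *\<^sub>R c) ` B)"
      using x unfolding B(3) h.span_image by (rule imageI)
    also have "\<dots> \<subseteq> rat_space.span (f ` (B \<times> C))"
      by (rule rat_space.span_mono) (use c in \<open>auto simp: f_def image_iff\<close>)
    finally show ?thesis .
  qed
  have TP: "t \<in> rat_space.span (f ` (B \<times> C)) \<and> t \<in> span C" if tT: "t \<in> T" for t
  proof -
    obtain x where x: "\<forall>c\<in>C. x c \<in> K" "t = (\<Sum>c\<in>C. x c *\<^sub>R c)" using comb[OF tT] by blast
    have "t \<in> rat_space.span (f ` (B \<times> C))"
      unfolding x(2)
    proof (rule rat_space.span_sum)
      show "x c *\<^sub>R c \<in> rat_space.span (f ` (B \<times> C))" if "c \<in> C" for c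
        using x(1) that by (intro scaleP) simp_all
    qed
    \<comment> \<open>Elements of \<open>K\<close> are real numbers, so a
      \<open>K\<close>-combination is also a real one.\<close>
    moreover have "t \<in> span C"
      unfolding x(2) by (intro span_sum span_scale span_base)
    ultimately show ?thesis by blast
  qed
  have "f ` (B \<times> C) \<subseteq> rat_space.span T"
  proof (rule image_subsetI)
    fix i assume "i \<in> B \<times> C"
    then obtain b c where i: "i = (b, c)" "b \<in> B" "c \<in> C" by blast
    have "b \<in> K" unfolding B(3) using i(2) by (rule rat_space.span_base)
    then show "f i \<in> rat_space.span T" using stable C(1) i by (auto simp: f_def)
  qed
  moreover have "T \<subseteq> rat_space.span (f ` (B \<times> C))" using TP by blast
  ultimately have "rat_space.span (f ` (B \<times> C)) = rat_space.span T"
    unfolding rat_space.span_eq by (rule conjI)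
  then have "rat_space.dim T = card (f ` (B \<times> C))"
    using P(2) by (rule rat_space.dim_eq_card)
  also have "\<dots> = card B * card C" using P(1) by (simp add: card_image card_cartesian_product)
  finally have "card T = card B * card C" using rat_space.dim_eq_card_independent[OF T(2)] by simp
  with C(1) TP show ?thesis by blast
qed

section \<open>The ring of multipliers of a module\<close>

text \<open>This is \<open>Scal M (mat 1)\<close> freed from matrices, so that it makes sense in
  every real vector space.\<close>

definition multipliers :: "'a::real_vector set \<Rightarrow> real set" where
  "multipliers M = {\<alpha>. \<forall>x\<in>M. \<alpha> *\<^sub>R x \<in> M}"

lemma multipliersD: "\<alpha> \<in> multipliers M \<Longrightarrow> x \<in> M \<Longrightarrow> \<alpha> *\<^sub>R x \<in> M"
  by (simp add: multipliers_def)

lemma int_subspace_multipliers: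
  assumes "int_module.subspace M"
  shows "int_module.subspace (multipliers M)"
proof (rule int_module.subspaceI)
  show "0 \<in> multipliers M" using int_module.subspace_0[OF assms] by (simp add: multipliers_def)
  show "\<alpha> + \<beta> \<in> multipliers M" if "\<alpha> \<in> multipliers M" "\<beta> \<in> multipliers M" for \<alpha> \<beta>
    using that int_module.subspace_add[OF assms] by (simp add: multipliers_def scaleR_add_left)
  show "real_of_int c *\<^sub>R \<alpha> \<in> multipliers M" if \<alpha>: "\<alpha> \<in> multipliers M" for c \<alpha>
    unfolding multipliers_def mem_Collect_eq
  proof
    fix x assume "x \<in> M"
    then have "real_of_int c *\<^sub>R (\<alpha> *\<^sub>R x) \<in> M"
      using int_module.subspace_scale[OF assms] multipliersD[OF \<alpha>] by blast
    then show "(real_of_int c *\<^sub>R \<alpha>) *\<^sub>R x \<in> M" by simp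
  qed
qed

lemma one_in_multipliers: "1 \<in> multipliers M"
  by (simp add: multipliers_def)

lemma mult_in_multipliers:
  assumes "\<alpha> \<in> multipliers M" "\<beta> \<in> multipliers M"
  shows "\<alpha> * \<beta> \<in> multipliers M"
  unfolding multipliers_def mem_Collect_eq
proof
  fix x assume "x \<in> M"
  then have "\<alpha> *\<^sub>R (\<beta> *\<^sub>R x) \<in> M" by (intro multipliersD[OF assms(1)] multipliersD[OF assms(2)])
  then show "(\<alpha> * \<beta>) *\<^sub>R x \<in> M" by simp
qed

text \<open>Applying multipliers to a fixed basis vector \<open>t\<close> embeds them into the
  module. The image has a basis by \<open>int_submodule_basis\<close>, and this basis is pulled back
  along the embedding.\<close>

lemma multipliers_basis:
  fixes T :: "'a::real_vector set"
  assumes T: "finite T" "rat_space.independent T" "T \<noteq> {}"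
  shows "\<exists>B. finite B \<and> rat_space.independent B \<and> multipliers (int_module.span T) = int_module.span B"
proof -
  let ?A = "multipliers (int_module.span T)"
  obtain t where t: "t \<in> T" using T(3) by blast
  have "t \<noteq> 0" using t T(2) rat_space.dependent_zero by blast
  interpret h: module_hom "\<lambda>(n::int) (x::real). real_of_int n *\<^sub>R x"
    "\<lambda>(n::int) (x::'a). real_of_int n *\<^sub>R x" "\<lambda>\<alpha>. \<alpha> *\<^sub>R t"
    by (rule int_module_hom_scaleR_left)
  have inj: "inj (\<lambda>\<alpha>. \<alpha> *\<^sub>R t)" using \<open>t \<noteq> 0\<close> by (simp add: inj_def)
  have sub: "int_module.subspace ((\<lambda>\<alpha>. \<alpha> *\<^sub>R t) ` ?A)"
    by (intro h.subspace_image int_subspace_multipliers int_module.subspace_span)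
  have subset: "(\<lambda>\<alpha>. \<alpha> *\<^sub>R t) ` ?A \<subseteq> int_module.span T"
    using multipliersD int_module.span_base[OF t] by blast
  from int_submodule_basis[OF T(1,2) sub subset] obtain B' where B': "finite B'" "rat_space.independent B'"
    "(\<lambda>\<alpha>. \<alpha> *\<^sub>R t) ` ?A = int_module.span B'" by (elim exE conjE)
  have "B' \<subseteq> (\<lambda>\<alpha>. \<alpha> *\<^sub>R t) ` ?A" unfolding B'(3) by (rule int_module.span_superset)
  then obtain B where B: "B' = (\<lambda>\<alpha>. \<alpha> *\<^sub>R t) ` B" by (auto simp: subset_image_iff)
  have "finite B" using B'(1) inj unfolding B by (meson finite_imageD inj_on_subset subset_UNIV)
  moreover have "rat_space.independent B"
  proof
    assume dep: "rat_space.dependent B"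
    then obtain S u where S: "finite S" "S \<subseteq> B" "(\<Sum>v\<in>S. of_rat (u v) *\<^sub>R v) = 0" "\<exists>v\<in>S. u v \<noteq> 0"
      unfolding rat_space.dependent_explicit by blast
    have "(\<Sum>v\<in>S. of_rat (u v) *\<^sub>R (v *\<^sub>R t)) = (\<Sum>v\<in>S. of_rat (u v) *\<^sub>R v) *\<^sub>R t"
      by (simp add: scaleR_sum_left)
    then have sum0: "(\<Sum>v\<in>S. of_rat (u v) *\<^sub>R (v *\<^sub>R t)) = 0" using S(3) by simp
    have injS: "inj_on (\<lambda>\<alpha>. \<alpha> *\<^sub>R t) S" using inj by (rule inj_on_subset) simp
    \<comment> \<open>The coefficients on \<open>S\<close> are carried over to the vectors
      \<open>v t\<close>; injectivity makes this well defined.\<close>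
    define w where "w y = u (the_inv_into S (\<lambda>\<alpha>. \<alpha> *\<^sub>R t) y)" for y
    have w: "w (v *\<^sub>R t) = u v" if "v \<in> S" for v
      unfolding w_def using the_inv_into_f_f[OF injS that] by simp
    have "(\<Sum>y\<in>(\<lambda>\<alpha>. \<alpha> *\<^sub>R t) ` S. of_rat (w y) *\<^sub>R y) = 0"
      using sum0 w by (simp add: sum.reindex[OF injS])
    then have "w (v *\<^sub>R t) = 0" if "v \<in> S" for v
      by (intro rat_space.independentD[OF B'(2), of "(\<lambda>\<alpha>. \<alpha> *\<^sub>R t) ` S"])
         (use S that B in auto)
    with S(4) w show False by auto
  qed
  moreover have "?A = int_module.span B"
    using B'(3) unfolding B h.span_image by (simp only: inj_image_eq_iff[OF inj])
  ultimately show ?thesis by blast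
qed

text \<open>The vectors \<open>\<alpha> t\<close> are independent, lie in the rational span of
  \<open>T\<close> and are as many as \<open>T\<close>, so they span the same rational space. Every
  \<open>t\<close> then has a multiple in the image, and a common multiple works for the whole
  module.\<close>

lemma multiplier_image_contains_multiple:
  fixes T :: "'a::real_vector set"
  assumes T: "finite T" "rat_space.independent T"
    and \<alpha>: "\<alpha> \<in> multipliers (int_module.span T)" "\<alpha> \<noteq> 0"
  shows "\<exists>n>0. \<forall>x\<in>int_module.span T. real_of_int n *\<^sub>R x \<in> (\<lambda>x. \<alpha> *\<^sub>R x) ` int_module.span T"
proof -
  let ?f = "\<lambda>x::'a. \<alpha> *\<^sub>R x"
  interpret h: module_hom "\<lambda>(n::int) (x::'a). real_of_int n *\<^sub>R x"
    "\<lambda>(n::int) (x::'a). real_of_int n *\<^sub>R x" ?f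
    by (rule int_module_hom_scaleR_right)
  interpret q: module_hom "\<lambda>(q::rat) (x::'a). (of_rat q :: real) *\<^sub>R x"
    "\<lambda>(q::rat) (x::'a). (of_rat q :: real) *\<^sub>R x" ?f
    by (rule rat_module_hom_scaleR_right)
  have inj: "inj ?f" using \<alpha>(2) by (simp add: inj_def)
  have ind: "rat_space.independent (?f ` T)"
    using T(2) by (rule q.independent_injective_image) (rule inj_on_subset[OF inj subset_UNIV])
  have sub: "?f ` T \<subseteq> rat_space.span T"
    using multipliersD[OF \<alpha>(1)] int_module.span_base int_span_subset_rat_span by blast
  have "t \<in> rat_space.span (?f ` T)" if t: "t \<in> T" for t
  proof (rule ccontr)
    assume nt: "t \<notin> rat_space.span (?f ` T)"
    then have "rat_space.independent (insert t (?f ` T))" using ind by (rule rat_space.independent_insertI)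
    moreover have "insert t (?f ` T) \<subseteq> rat_space.span T" using sub rat_space.span_base[OF t] by blast
    ultimately have "card (insert t (?f ` T)) \<le> card T"
      using rat_space.independent_span_bound[OF T(1)] by blast
    moreover have "t \<notin> ?f ` T" using nt rat_space.span_base[of t "?f ` T"] by blast
    moreover have "card (?f ` T) = card T" by (rule card_image) (rule inj_on_subset[OF inj subset_UNIV])
    ultimately show False using T(1) by simp
  qed
  then have "\<exists>n>0. real_of_int n *\<^sub>R t \<in> ?f ` int_module.span T" if "t \<in> T" for t
    using rat_span_int_multiple[of t "?f ` T"] that unfolding h.span_image by blast
  then show ?thesis
    by (intro int_span_common_multiple[OF T(1)] h.subspace_image int_module.subspace_span)
qed

section \<open>Integrality of multipliers\<close>

text \<open>The bridge from spans of powers to the polynomials in \<open>algebraic_int\<close>. The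
  bound is put as vanishing coefficients and not as a strict degree bound, so that it is also right
  for \<open>N = 0\<close>.\<close>

lemma int_span_powers_poly:
  fixes \<alpha> :: real
  assumes "x \<in> int_module.span ((\<lambda>n. \<alpha> ^ n) ` {..<N})"
  shows "\<exists>p. (\<forall>i\<ge>N. Polynomial.coeff p i = 0) \<and> (\<forall>i. Polynomial.coeff p i \<in> \<int>) \<and> poly p \<alpha> = x"
  using assms
proof (induction rule: int_module.span_induct_alt)
  case base
  show ?case by (intro exI[of _ 0]) simp
next
  case (step c x y)
  then obtain p m where "m < N" "x = \<alpha> ^ m" "\<forall>i\<ge>N. Polynomial.coeff p i = 0"
    "\<forall>i. Polynomial.coeff p i \<in> \<int>" "poly p \<alpha> = y" by blast
  then show ?case
    by (intro exI[of _ "Polynomial.monom (of_int c) m + p"]) (simp add: poly_monom)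
qed

text \<open>The \<open>\<int>\<close>-module generated by the powers of \<open>\<alpha>\<close> is finitely generated, so some power is an
  integer combination of lower ones; no determinant is needed.\<close>

lemma algebraic_int_if_powers_in_int_span:
  fixes \<alpha> :: real
  assumes B: "finite B" "rat_space.independent B" and pow: "\<And>n. \<alpha> ^ n \<in> int_module.span B"
  shows "algebraic_int \<alpha>"
proof -
  let ?S = "int_module.span (range (\<lambda>n. \<alpha> ^ n))"
  have "?S \<subseteq> int_module.span B"
    using pow by (intro int_module.span_minimal int_module.subspace_span) blast
  then obtain B' where B': "finite B'" "?S = int_module.span B'"
    using int_submodule_basis[OF B, of ?S] int_module.subspace_span by blast
  let ?L = "\<lambda>N. int_module.span ((\<lambda>n. \<alpha> ^ n) ` {..<N})"
  have mono: "?L i \<subseteq> ?L j" if "i \<le> j" for i j :: nat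
    using that by (intro int_module.span_mono) auto
  have "\<exists>N. b \<in> ?L N" if "b \<in> ?S" for b
    using that
  proof (induction rule: int_module.span_induct_alt)
    case base
    show ?case using int_module.span_zero by blast
  next
    case (step c x y)
    then obtain m N where mN: "x = \<alpha> ^ m" "y \<in> ?L N" by blast
    have "x \<in> ?L (max (Suc m) N)" using mN(1) by (intro int_module.span_base) auto
    moreover have "y \<in> ?L (max (Suc m) N)" using mN(2) mono[of N "max (Suc m) N"] by auto
    ultimately have "real_of_int c *\<^sub>R x + y \<in> ?L (max (Suc m) N)"
      by (intro int_module.span_add int_module.span_scale)
    then show ?case by blast
  qed
  then have "\<forall>b\<in>B'. \<exists>N. b \<in> ?L N" unfolding B'(2) using int_module.span_base by blast
  then obtain g where g: "\<forall>b\<in>B'. b \<in> ?L (g b)" by metis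
  \<comment> \<open>The sum dominates each \<open>g b\<close>, so all generators lie in one member
    of the chain \<open>?L\<close>.\<close>
  define N where "N = sum g B'"
  have "B' \<subseteq> ?L N"
  proof
    fix b assume b: "b \<in> B'"
    have "g b \<le> N" unfolding N_def using B'(1) b by (intro member_le_sum) auto
    with g b mono show "b \<in> ?L N" by blast
  qed
  then have "?S \<subseteq> ?L N" unfolding B'(2) by (intro int_module.span_minimal int_module.subspace_span)
  moreover have "\<alpha> ^ N \<in> ?S" by (intro int_module.span_base) blast
  ultimately have "\<alpha> ^ N \<in> ?L N" by blast
  then obtain p where p: "\<forall>i\<ge>N. Polynomial.coeff p i = 0" "\<forall>i. Polynomial.coeff p i \<in> \<int>"
    "poly p \<alpha> = \<alpha> ^ N"
    using int_span_powers_poly by blast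
  \<comment> \<open>Since \<open>p\<close> involves only powers below \<open>N\<close>,
    \<open>P\<close> is monic of degree \<open>N\<close>.\<close>
  define P where "P = Polynomial.monom 1 N - p"
  have P: "Polynomial.coeff P N = 1" "\<forall>i>N. Polynomial.coeff P i = 0" using p(1) by (simp_all add: P_def)
  then have "Polynomial.degree P = N"
    by (intro antisym Polynomial.degree_le Polynomial.le_degree) simp_all
  with P(1) have "Polynomial.lead_coeff P = 1" by simp
  moreover have "\<forall>i. Polynomial.coeff P i \<in> \<int>" using p(2) by (simp add: P_def)
  moreover have "poly P \<alpha> = 0" by (simp add: P_def poly_monom p(3))
  ultimately show ?thesis by (rule algebraic_int.intros)
qed

section \<open>Inverses and commensurability\<close>

text \<open>From \<open>n x = \<alpha> y\<close> with \<open>y\<close> in the module it follows that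
  \<open>(n / \<alpha>) x = y\<close>.\<close>

lemma inverse_multiplier:
  fixes T :: "'a::real_vector set"
  assumes T: "finite T" "rat_space.independent T"
    and \<alpha>: "\<alpha> \<in> multipliers (int_module.span T)" "\<alpha> \<noteq> 0"
  shows "\<exists>n>0. real_of_int n * inverse \<alpha> \<in> multipliers (int_module.span T)"
proof -
  obtain n where n: "n > 0"
    "\<forall>x\<in>int_module.span T. real_of_int n *\<^sub>R x \<in> (\<lambda>x. \<alpha> *\<^sub>R x) ` int_module.span T"
    using multiplier_image_contains_multiple[OF assms] by blast
  have "(real_of_int n * inverse \<alpha>) *\<^sub>R x \<in> int_module.span T" if x: "x \<in> int_module.span T" for x
  proof -
    obtain y where y: "real_of_int n *\<^sub>R x = \<alpha> *\<^sub>R y" "y \<in> int_module.span T" using n(2) x by blast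
    have "(real_of_int n * inverse \<alpha>) *\<^sub>R x = inverse \<alpha> *\<^sub>R (real_of_int n *\<^sub>R x)" by (simp add: mult.commute)
    also have "\<dots> = y" unfolding y(1) using \<alpha>(2) by simp
    finally show ?thesis using y(2) by simp
  qed
  with n(1) show ?thesis unfolding multipliers_def by blast
qed

lemma rat_span_iff:
  "x \<in> rat_space.span T \<longleftrightarrow> (\<exists>n>0. real_of_int n *\<^sub>R x \<in> int_module.span T)"
proof
  assume "\<exists>n>0. real_of_int n *\<^sub>R x \<in> int_module.span T"
  then obtain n where n: "n > 0" "real_of_int n *\<^sub>R x \<in> rat_space.span T"
    using int_span_subset_rat_span by blast
  have "(of_rat (inverse (of_int n)) :: real) *\<^sub>R (real_of_int n *\<^sub>R x) \<in> rat_space.span T"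
    using n(2) by (rule rat_space.span_scale)
  then show "x \<in> rat_space.span T" using n(1) by (simp add: of_rat_inverse)
qed (rule rat_span_int_multiple)

text \<open>A multiple of an element of one span stays in that span, so lying in the intersection is
  only a condition on the other span; the rest is \<open>finite_cosets_iff\<close> on both
  sides.\<close>

lemma commensurate_int_span_iff:
  assumes "finite S" "finite T"
  shows "commensurate (int_module.span S) (int_module.span T) \<longleftrightarrow>
    (\<exists>n>0. \<forall>x\<in>int_module.span S. real_of_int n *\<^sub>R x \<in> int_module.span T) \<and>
    (\<exists>n>0. \<forall>x\<in>int_module.span T. real_of_int n *\<^sub>R x \<in> int_module.span S)"
proof -
  let ?N = "int_module.span S \<inter> int_module.span T"
  have N: "int_module.subspace ?N" by (intro int_module.subspace_inter int_module.subspace_span)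
  have "finite_index_submodule ?N (int_module.span S) \<longleftrightarrow>
      (\<exists>n>0. \<forall>x\<in>int_module.span S. real_of_int n *\<^sub>R x \<in> int_module.span T)"
    unfolding finite_index_submodule_def finite_cosets_iff[OF assms(1) N]
    using N int_module.span_scale[of _ S] by blast
  moreover have "finite_index_submodule ?N (int_module.span T) \<longleftrightarrow>
      (\<exists>n>0. \<forall>x\<in>int_module.span T. real_of_int n *\<^sub>R x \<in> int_module.span S)"
    unfolding finite_index_submodule_def finite_cosets_iff[OF assms(2) N]
    using N int_module.span_scale[of _ T] by blast
  ultimately show ?thesis unfolding commensurate_def by simp
qed

lemma Scal_mat_1: "Scal M (mat 1) = multipliers M"
  unfolding Scal_def multipliers_def by auto

text \<open>Commensurability of \<open>\<alpha> M\<close> and \<open>M\<close> splits into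
  \<open>n \<alpha> M\<close> inside \<open>M\<close> and \<open>n M\<close> inside
  \<open>\<alpha> M\<close>. For nonzero \<open>\<alpha>\<close> the first half implies the second.
  For zero the first half always holds, which is why 0 is adjoined on the left.\<close>

lemma scal_mat_1:
  fixes T :: "(real ^ 'n) set"
  assumes T: "finite T" "rat_space.independent T"
  shows "insert 0 (scal (int_module.span T) (mat 1)) =
    {\<alpha>. \<exists>n>0. real_of_int n * \<alpha> \<in> multipliers (int_module.span T)}" (is "_ = ?K")
proof -
  let ?M = "int_module.span T"
  have scal_iff: "\<alpha> \<in> scal ?M (mat 1) \<longleftrightarrow>
      (\<exists>n>0. real_of_int n * \<alpha> \<in> multipliers ?M) \<and>
      (\<exists>n>0. \<forall>x\<in>?M. real_of_int n *\<^sub>R x \<in> (\<lambda>x. \<alpha> *\<^sub>R x) ` ?M)" for \<alpha>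
  proof -
    interpret h: module_hom "\<lambda>(n::int) (x::real ^ 'n). real_of_int n *\<^sub>R x"
      "\<lambda>(n::int) (x::real ^ 'n). real_of_int n *\<^sub>R x" "\<lambda>x. \<alpha> *\<^sub>R x"
      by (rule int_module_hom_scaleR_right)
    have "\<alpha> \<in> scal ?M (mat 1) \<longleftrightarrow> commensurate (int_module.span ((\<lambda>x. \<alpha> *\<^sub>R x) ` T)) ?M"
      unfolding scal_def h.span_image by simp
    also have "\<dots> \<longleftrightarrow> (\<exists>n>0. \<forall>x\<in>(\<lambda>x. \<alpha> *\<^sub>R x) ` ?M. real_of_int n *\<^sub>R x \<in> ?M) \<and>
      (\<exists>n>0. \<forall>x\<in>?M. real_of_int n *\<^sub>R x \<in> (\<lambda>x. \<alpha> *\<^sub>R x) ` ?M)"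
      using commensurate_int_span_iff[OF finite_imageI[OF T(1), of "\<lambda>x. \<alpha> *\<^sub>R x"] T(1)] unfolding h.span_image .
    finally show ?thesis unfolding multipliers_def by simp
  qed
  show ?thesis
  proof
    have "(0::real) \<in> multipliers ?M"
      using int_module.subspace_0[OF int_subspace_multipliers[OF int_module.subspace_span]] .
    then have "0 \<in> ?K" by (auto intro: exI[of _ 1])
    then show "insert 0 (scal ?M (mat 1)) \<subseteq> ?K" using scal_iff by blast
    show "?K \<subseteq> insert 0 (scal ?M (mat 1))"
    proof
      fix \<alpha> assume K: "\<alpha> \<in> ?K"
      then obtain m where m: "m > 0" "real_of_int m * \<alpha> \<in> multipliers ?M" by blast
      show "\<alpha> \<in> insert 0 (scal ?M (mat 1))"
      proof (cases "\<alpha> = 0")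
        case False
        with m(1) have "real_of_int m * \<alpha> \<noteq> 0" by simp
        then obtain n where n: "n > 0"
          "\<forall>x\<in>?M. real_of_int n *\<^sub>R x \<in> (\<lambda>x. (real_of_int m * \<alpha>) *\<^sub>R x) ` ?M"
          using multiplier_image_contains_multiple[OF T m(2)] by blast
        \<comment> \<open>A multiple of the module lies in \<open>(m \<alpha>) M\<close>, hence also
          in \<open>\<alpha> M\<close>, because \<open>m M\<close> lies in \<open>M\<close>.\<close>
        have "(\<lambda>x. (real_of_int m * \<alpha>) *\<^sub>R x) ` ?M \<subseteq> (\<lambda>x. \<alpha> *\<^sub>R x) ` ?M"
        proof (rule image_subsetI)
          fix x assume "x \<in> ?M"
          then have "real_of_int m *\<^sub>R x \<in> ?M" by (rule int_module.span_scale)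
          moreover have "(real_of_int m * \<alpha>) *\<^sub>R x = \<alpha> *\<^sub>R (real_of_int m *\<^sub>R x)"
            by (simp add: mult.commute)
          ultimately show "(real_of_int m * \<alpha>) *\<^sub>R x \<in> (\<lambda>x. \<alpha> *\<^sub>R x) ` ?M" by blast
        qed
        with n have "\<exists>n>0. \<forall>x\<in>?M. real_of_int n *\<^sub>R x \<in> (\<lambda>x. \<alpha> *\<^sub>R x) ` ?M" by blast
        with K scal_iff show ?thesis by blast
      qed simp
    qed
  qed
qed

section \<open>Subrings and subfields of a field given as a type\<close>

lemma subring_ring_of_type_algebraI:
  fixes A :: "'a::Fields.field set"
  assumes "1 \<in> A" "\<And>x. x \<in> A \<Longrightarrow> - x \<in> A"
    "\<And>x y. x \<in> A \<Longrightarrow> y \<in> A \<Longrightarrow> x * y \<in> A" "\<And>x y. x \<in> A \<Longrightarrow> y \<in> A \<Longrightarrow> x + y \<in> A"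
  shows "subring A ring_of_type_algebra"
proof -
  interpret F: Ring.field "ring_of_type_algebra :: 'a ring" by (rule field_from_type_algebra)
  \<comment> \<open>The additive inverse of the record is defined only through its property, so it
    is identified by uniqueness.\<close>
  have minus: "\<ominus>\<^bsub>ring_of_type_algebra\<^esub> x = - x" for x :: 'a
    by (rule F.minus_equality) (simp_all add: ring_of_type_algebra_def)
  show ?thesis
    by (rule F.subringI) (use assms in \<open>simp_all add: minus\<close>, simp_all add: ring_of_type_algebra_def)
qed

text \<open>The hypothesis on inverses covers 0 as well, where \<open>inverse 0 = 0\<close> keeps it
  harmless.\<close>

lemma subfield_ring_of_type_algebraI:
  fixes K :: "'a::Fields.field set"
  assumes "subring K ring_of_type_algebra" "\<And>x. x \<in> K \<Longrightarrow> inverse x \<in> K"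
  shows "subfield K ring_of_type_algebra"
proof -
  interpret F: Ring.field "ring_of_type_algebra :: 'a ring" by (rule field_from_type_algebra)
  show ?thesis
  proof (rule F.subfieldI'[OF assms(1)])
    fix x assume x: "x \<in> K - {\<zero>\<^bsub>ring_of_type_algebra\<^esub>}"
    have "inv\<^bsub>ring_of_type_algebra\<^esub> x = inverse x"
      by (rule F.comm_inv_char) (use x in \<open>simp_all add: ring_of_type_algebra_def\<close>)
    with x assms(2) show "inv\<^bsub>ring_of_type_algebra\<^esub> x \<in> K" by simp
  qed
qed

theorem theorem12:
  fixes M :: "(real ^ 'n) set" and k :: nat
  assumes "free_int_module_in_space M k"
  shows "subring (Scal M (mat 1)) ring_of_type_algebra
       \<and> (\<forall>\<alpha>\<in>Scal M (mat 1). algebraic_int \<alpha>)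
       \<and> (\<exists>r. free_int_module_of_rank (Scal M (mat 1)) r
              \<and> r dvd k \<and> real r \<le> real k / real CARD('n))
       \<and> field_of_quotients (insert 0 (scal M (mat 1))) (Scal M (mat 1))"
proof -
  obtain T where T: "finite T" "rat_space.independent T" and card_T: "card T = k"
    and span_T: "span T = UNIV" and M: "M = int_module.span T"
    using assms unfolding free_int_module_in_space_def by blast
  \<comment> \<open>The index type is nonempty, so the space is nonzero and \<open>T\<close> cannot
    be empty; a basis vector is needed to embed the multipliers.\<close>
  have "(UNIV :: (real ^ 'n) set) \<noteq> {0}"
    by (metis (full_types) UNIV_I singletonD zero_neq_one)
  then have "T \<noteq> {}" using span_T by (metis span_empty)
  define A where "A = multipliers M"
  have A_sub: "int_module.subspace A"
    unfolding A_def M by (intro int_subspace_multipliers int_module.subspace_span)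
  obtain B where B: "finite B" "rat_space.independent B" and A_span: "A = int_module.span B"
    using multipliers_basis[OF T \<open>T \<noteq> {}\<close>] unfolding A_def M by blast
  have A1: "1 \<in> A" unfolding A_def by (rule one_in_multipliers)
  have Amult: "x * y \<in> A" if "x \<in> A" "y \<in> A" for x y
    using that unfolding A_def by (rule mult_in_multipliers)
  have Ascale: "real_of_int n * x \<in> A" if "x \<in> A" for n x
    using int_module.subspace_scale[OF A_sub that, of n] by simp
  have ring: "subring A ring_of_type_algebra"
    by (intro subring_ring_of_type_algebraI A1 Amult int_module.subspace_neg[OF A_sub]
        int_module.subspace_add[OF A_sub])
  have algebraic: "algebraic_int \<alpha>" if \<alpha>: "\<alpha> \<in> A" for \<alpha>
  proof (rule algebraic_int_if_powers_in_int_span[OF B])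
    show "\<alpha> ^ n \<in> int_module.span B" for n
      unfolding A_span[symmetric] by (induction n) (simp_all add: A1 Amult \<alpha>)
  qed
  \<comment> \<open>\<open>K\<close> is the rational span of \<open>A\<close>, and its degree over
    the rationals is \<open>card B\<close>.\<close>
  define K where "K = rat_space.span B"
  have K_iff: "x \<in> K \<longleftrightarrow> (\<exists>n>0. real_of_int n * x \<in> A)" for x
    unfolding K_def A_span rat_span_iff by simp
  have AK: "x \<in> K" if "x \<in> A" for x
    unfolding K_iff using that by (intro exI[of _ 1]) simp
  have Kmult: "x * y \<in> K" if xK: "x \<in> K" and yK: "y \<in> K" for x y
  proof -
    obtain m n where mn: "m > 0" "n > 0" "real_of_int m * x \<in> A" "real_of_int n * y \<in> A"
      using xK yK unfolding K_iff by blast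
    have "real_of_int (m * n) * (x * y) \<in> A" using Amult[OF mn(3,4)] by (simp add: mult_ac)
    with mn(1,2) show ?thesis unfolding K_iff by (intro exI[of _ "m * n"]) simp
  qed
  have Kinv: "inverse x \<in> K" if xK: "x \<in> K" for x
  proof (cases "x = 0")
    case True
    with xK show ?thesis by simp
  next
    case False
    obtain m where m: "m > 0" "real_of_int m * x \<in> A" using xK unfolding K_iff by blast
    then obtain n where n: "n > 0" "real_of_int n * inverse (real_of_int m * x) \<in> A"
      using inverse_multiplier[OF T, of "real_of_int m * x"] False unfolding A_def M by auto
    \<comment> \<open>Multiplying \<open>n / (m x)\<close> by \<open>m\<close> stays in
      \<open>A\<close> and gives \<open>n / x\<close>.\<close>
    have "real_of_int m * (real_of_int n * inverse (real_of_int m * x)) = real_of_int n * inverse x"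
      using m(1) by (simp add: field_simps)
    with Ascale[OF n(2), of m] have "real_of_int n * inverse x \<in> A" by (simp only:)
    with n(1) show ?thesis unfolding K_iff by blast
  qed
  have K_sub: "rat_space.subspace K" unfolding K_def by (rule rat_space.subspace_span)
  have stable: "x *\<^sub>R v \<in> rat_space.span T" if xK: "x \<in> K" and v: "v \<in> T" for x v
  proof -
    obtain n where n: "n > 0" "real_of_int n * x \<in> multipliers M"
      using xK unfolding K_iff A_def by blast
    have "(real_of_int n * x) *\<^sub>R v \<in> int_module.span T"
      using multipliersD[OF n(2)] int_module.span_base[OF v] unfolding M by blast
    then have "real_of_int n *\<^sub>R (x *\<^sub>R v) \<in> int_module.span T" by simp
    with n(1) show ?thesis unfolding rat_span_iff by blast
  qed
  \<comment> \<open>With r = \<open>card B\<close>, the cardinality of \<open>C\<close> is k / r.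
    Since \<open>T\<close> spans the space over the reals, so does \<open>C\<close>; hence
    \<open>card C\<close> is at least the dimension, which bounds r.\<close>
  obtain C where C: "C \<subseteq> T" "card T = card B * card C" "T \<subseteq> span C"
    using card_rat_basis_over_number_field[OF B K_def AK[OF A1] Kmult Kinv T stable] by blast
  have "UNIV \<subseteq> span C" using span_minimal[OF C(3) subspace_span] span_T by simp
  moreover have "finite C" using C(1) T(1) by (rule finite_subset)
  ultimately have "dim (UNIV :: (real ^ 'n) set) \<le> card C" by (rule dim_le_card)
  then have "CARD('n) \<le> card C" by simp
  then have "card B * CARD('n) \<le> k" using C(2) card_T by simp
  then have "real (card B) * real CARD('n) \<le> real k" by (simp flip: of_nat_mult)
  then have "real (card B) \<le> real k / real CARD('n)" by (simp add: pos_le_divide_eq)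
  moreover have "free_int_module_of_rank A (card B)"
    unfolding free_int_module_of_rank_def
    using B A_span rat_independent_imp_int_independent by blast
  moreover have "card B dvd k" using C(2) card_T by simp
  ultimately have rank: "\<exists>r. free_int_module_of_rank A r \<and> r dvd k \<and> real r \<le> real k / real CARD('n)"
    by blast
  have "subfield K ring_of_type_algebra"
    by (intro subfield_ring_of_type_algebraI subring_ring_of_type_algebraI Kmult Kinv AK[OF A1]
        rat_space.subspace_neg[OF K_sub] rat_space.subspace_add[OF K_sub])
  moreover have "K = {a / b |a b. a \<in> A \<and> b \<in> A \<and> b \<noteq> 0}"
  proof (intro Set.set_eqI iffI)
    fix x assume "x \<in> K"
    then obtain n where n: "n > 0" "real_of_int n * x \<in> A" unfolding K_iff by blast
    \<comment> \<open>The integer \<open>n\<close> lies in \<open>A\<close> as a multiple of 1 and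
      serves as denominator.\<close>
    have "x = (real_of_int n * x) / real_of_int n" "real_of_int n \<in> A"
      using n(1) Ascale[OF A1, of n] by simp_all
    with n show "x \<in> {a / b |a b. a \<in> A \<and> b \<in> A \<and> b \<noteq> 0}" by force
  next
    fix x assume "x \<in> {a / b |a b. a \<in> A \<and> b \<in> A \<and> b \<noteq> 0}"
    then obtain a b where "x = a * inverse b" "a \<in> A" "b \<in> A" by (auto simp: divide_inverse)
    then show "x \<in> K" using AK Kmult Kinv by blast
  qed
  moreover have "insert 0 (scal M (mat 1)) = K"
    unfolding M scal_mat_1[OF T] using K_iff unfolding A_def M by blast
  ultimately have "field_of_quotients (insert 0 (scal M (mat 1))) A"
    unfolding field_of_quotients_def by simp
  with ring algebraic rank show ?thesis unfolding Scal_mat_1 A_def by blast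
qed

end
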